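(* Let $$\mathcal Z_1=\Big\{\bm X\in\mathcal D:\ \inf_{\mathbb P\in\mathcal P}\mathbb P\Big\{\sum_{t\in\mathcal T}[t-\tilde\omega_j]_+\,x_{jt}\le\rho\Big\}\ge 1-\epsilon\ \text{ for all } j\in\mathcal J\Big\}.$$ Then $\mathcal Z_1$ admits the integer programming representation $$\mathcal Z_1=\{\bm X\in\mathcal D:\ x_{jt}\le u_{jt},\ j\in\mathcal J,\ t\in\mathcal T\},$$ where $$u_{jt}=\mathbb I\Big[\inf_{\mathbb P\in\mathcal P_j}\mathbb P\big\{[t-\tilde\omega_j]_+\le\rho\big\}\ge 1-\epsilon\Big],\quad j\in\mathcal J,\ t\in\mathcal T,$$ are constant binary values (not depending on $\bm X$).
   Context: $[\cdot]_+=\max(0,\cdot)$; $\mathbb I$ is the indicator (equal to 1 if the condition holds, 0 otherwise). $\rho\ge 0$ and $\epsilon\in(0,1)$ are given constants. Sets: $\mathcal J=\{1,\dots,J\}$ components, $\mathcal K=\{1,\dots,K\}$ machines, $\mathcal L=\{1,\dots,L\}$ spare-part types, $\mathcal T=\{1,\dots,T_{max}\}$ periods. $\mathcal J$ is the disjoint union of the sets $\mathcal J_k$ (components of machine $k$), and $\mathcal M_l\subseteq\mathcal J$ is the set of components of type $l$. Uncertainty: $\tilde\omega_j$ is a random variable with values in $\Xi_j=[0,\tau_j^{\max}]$, and $\tilde\Omega=(\tilde\omega_1,\dots,\tilde\omega_J)$ has independent coordinates. For each $j$, $\widehat{\mathrm{RLD}}_j$ is a given probability distribution on $\Xi_j$,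 $\delta_j\ge0$, $\varphi$ is a given discrepancy functional between probability distributions (nonnegative, zero when the two arguments are equal), $$\mathcal P_j=\{\mathbb P:\ \mathbb P\{\tilde\omega_j\in\Xi_j\}=1,\ \varphi(\mathbb P,\widehat{\mathrm{RLD}}_j)\le\delta_j\},$$ and $\mathcal P=\{\mathbb P_1\otimes\cdots\otimes\mathbb P_J:\ \mathbb P_j\in\mathcal P_j\}$. Deterministic feasible set $\mathcal D$: the set of all vectors $\bm X=(x_{jt},y_{kt},z_t,h_{lt},g^{reg}_{lt},g^{exp}_{lt},r_t)$ with $x_{jt},y_{kt},z_t,r_t\in\{0,1\}$ and $h_{lt},g^{reg}_{lt},g^{exp}_{lt}\in\mathbb Z_+$ such that - $\sum_{t\in\mathcal T}x_{jt}=1$ for all $j\in\mathcal J$; - $\sum_{j\in\mathcal J}x_{jt}\le M z_t$ for all $t\in\mathcal T$; - $\sum_{j\in\mathcal J_k}x_{jt}\le|\mathcal J_k|\,y_{kt}$ for all $k\in\mathcal K$, $t\in\mathcal T$; - $\sum_{l\in\mathcal L}g^{reg}_{lt}\le G_t r_t$ for all $t\in\mathcal T$; - $h_{lt}=h_{l,t-1}+g^{exp}_{lt}+\hat g_{lt}-\sum_{j\in\mathcal M_l}x_{jt}$ for all $l\in\mathcal L,t\in\mathcal T$, where $\hat g_{lt}=g^{reg}_{l,t-\Delta^{reg}}$ if $t\ge\Delta^{reg}+1$, and $\hat g_{lt}=\tilde g^{reg}_{l,t-\Delta^{reg}}$ (given past orders) if $1\le t\le\Delta^{reg}$. Here $M$,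 $G_t$, the lead time $\Delta^{reg}\in\mathbb Z_{>0}$, the initial inventories $h_{l0}$ and the past orders $\tilde g^{reg}$ are given nonnegative data. *)

theory Defs
  imports "HOL-Probability.Probability"
begin

record maintenance_data =
  n_comp :: nat
  n_mach :: nat
  n_type :: nat
  horizon :: nat
  comps_of_mach :: "nat \<Rightarrow> nat set"
  comps_of_type :: "nat \<Rightarrow> nat set"
  big_M :: real
  order_cap :: "nat \<Rightarrow> real"
  lead_time :: nat
  init_inv :: "nat \<Rightarrow> real"
  past_order :: "nat \<Rightarrow> int \<Rightarrow> real"  \<comment> \<open>the period index ranges over \<open>1 - lead_time, \<dots>, 0\<close>\<close>
  tau_max :: "nat \<Rightarrow> real"
  RLD :: "nat \<Rightarrow> real measure"
  radius :: "nat \<Rightarrow> real"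
  discrepancy :: "real measure \<Rightarrow> real measure \<Rightarrow> ereal"  \<comment> \<open>\<open>\<infinity>\<close> is allowed, as for divergences\<close>
  tolerance :: real
  risk :: real

abbreviation comps :: "maintenance_data \<Rightarrow> nat set" where "comps d \<equiv> {1..n_comp d}"
abbreviation machs :: "maintenance_data \<Rightarrow> nat set" where "machs d \<equiv> {1..n_mach d}"
abbreviation types :: "maintenance_data \<Rightarrow> nat set" where "types d \<equiv> {1..n_type d}"
abbreviation periods :: "maintenance_data \<Rightarrow> nat set" where "periods d \<equiv> {1..horizon d}"

abbreviation support :: "maintenance_data \<Rightarrow> nat \<Rightarrow> real set" where
  "support d j \<equiv> {0..tau_max d j}"

definition borel_distributions :: "real measure set" where
  "borel_distributions = {P. prob_space P \<and> sets P = sets borel}"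

definition valid_data :: "maintenance_data \<Rightarrow> bool" where
  "valid_data d \<longleftrightarrow>
     (\<Union>k\<in>machs d. comps_of_mach d k) = comps d \<and>
     disjoint_family_on (comps_of_mach d) (machs d) \<and>
     (\<forall>l\<in>types d. comps_of_type d l \<subseteq> comps d) \<and>
     0 \<le> big_M d \<and>
     (\<forall>t\<in>periods d. 0 \<le> order_cap d t) \<and>
     0 < lead_time d \<and>
     (\<forall>l\<in>types d. 0 \<le> init_inv d l) \<and>
     (\<forall>l\<in>types d. \<forall>s\<in>{1 - int (lead_time d)..0}. 0 \<le> past_order d l s) \<and>
     (\<forall>j\<in>comps d. RLD d j \<in> borel_distributions \<and> measure (RLD d j) (support d j) = 1) \<and>
     (\<forall>j\<in>comps d. 0 \<le> radius d j) \<and>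
     (\<forall>P\<in>borel_distributions. \<forall>Q\<in>borel_distributions. 0 \<le> discrepancy d P Q) \<and>
     (\<forall>P\<in>borel_distributions. discrepancy d P P = 0) \<and>
     0 \<le> tolerance d \<and>
     0 < risk d \<and> risk d < 1"

record plan =
  xv :: "nat \<Rightarrow> nat \<Rightarrow> real"
  yv :: "nat \<Rightarrow> nat \<Rightarrow> real"
  zv :: "nat \<Rightarrow> real"
  hv :: "nat \<Rightarrow> nat \<Rightarrow> real"
  greg :: "nat \<Rightarrow> nat \<Rightarrow> real"
  gexp :: "nat \<Rightarrow> nat \<Rightarrow> real"
  rv :: "nat \<Rightarrow> real"

definition prev_inv :: "maintenance_data \<Rightarrow> plan \<Rightarrow> nat \<Rightarrow> nat \<Rightarrow> real" where
  "prev_inv d X l t = (if t = 1 then init_inv d l else hv X l (t - 1))"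

definition reg_arrival :: "maintenance_data \<Rightarrow> plan \<Rightarrow> nat \<Rightarrow> nat \<Rightarrow> real" where
  "reg_arrival d X l t =
     (if lead_time d + 1 \<le> t then greg X l (t - lead_time d)
      else past_order d l (int t - int (lead_time d)))"

text \<open>
  The extensional function spaces make a plan a finite vector: nothing but the entries
  at the listed indices is left free.
\<close>

definition feasible_plans :: "maintenance_data \<Rightarrow> plan set" where
  "feasible_plans d = {X.
     xv X \<in> comps d \<rightarrow>\<^sub>E (periods d \<rightarrow>\<^sub>E {0, 1}) \<and>
     yv X \<in> machs d \<rightarrow>\<^sub>E (periods d \<rightarrow>\<^sub>E {0, 1}) \<and>
     zv X \<in> periods d \<rightarrow>\<^sub>E {0, 1} \<and>
     hv X \<in> types d \<rightarrow>\<^sub>E (periods d \<rightarrow>\<^sub>E \<nat>) \<and>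
     greg X \<in> types d \<rightarrow>\<^sub>E (periods d \<rightarrow>\<^sub>E \<nat>) \<and>
     gexp X \<in> types d \<rightarrow>\<^sub>E (periods d \<rightarrow>\<^sub>E \<nat>) \<and>
     rv X \<in> periods d \<rightarrow>\<^sub>E {0, 1} \<and>
     (\<forall>j\<in>comps d. (\<Sum>t\<in>periods d. xv X j t) = 1) \<and>
     (\<forall>t\<in>periods d. (\<Sum>j\<in>comps d. xv X j t) \<le> big_M d * zv X t) \<and>
     (\<forall>k\<in>machs d. \<forall>t\<in>periods d.
        (\<Sum>j\<in>comps_of_mach d k. xv X j t) \<le> real (card (comps_of_mach d k)) * yv X k t) \<and>
     (\<forall>t\<in>periods d. (\<Sum>l\<in>types d. greg X l t) \<le> order_cap d t * rv X t) \<and>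
     (\<forall>l\<in>types d. \<forall>t\<in>periods d.
        hv X l t = prev_inv d X l t + gexp X l t + reg_arrival d X l t
                   - (\<Sum>j\<in>comps_of_type d l. xv X j t))}"

definition ambiguity :: "maintenance_data \<Rightarrow> nat \<Rightarrow> real measure set" where
  "ambiguity d j = {P \<in> borel_distributions.
     measure P (support d j) = 1 \<and> discrepancy d P (RLD d j) \<le> ereal (radius d j)}"

definition joint_ambiguity :: "maintenance_data \<Rightarrow> (nat \<Rightarrow> real) measure set" where
  "joint_ambiguity d = {PiM (comps d) Q | Q. \<forall>j\<in>comps d. Q j \<in> ambiguity d j}"

text \<open>
  The random vector is the identity on the product space, so its coordinate \<open>j\<close> is
  \<open>\<lambda>\<omega>. \<omega> j\<close>. Both infima below are over nonempty families of numbers in \<open>[0, 1]\<close>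
  (for valid data, \<open>RLD d j \<in> ambiguity d j\<close>), so the infimum on \<open>real\<close> is the usual one.
\<close>

definition Z1 :: "maintenance_data \<Rightarrow> plan set" where
  "Z1 d = {X \<in> feasible_plans d. \<forall>j\<in>comps d.
     (INF P\<in>joint_ambiguity d.
        measure P {\<omega> \<in> space P. (\<Sum>t\<in>periods d. max 0 (real t - \<omega> j) * xv X j t) \<le> tolerance d})
     \<ge> 1 - risk d}"

definition u :: "maintenance_data \<Rightarrow> nat \<Rightarrow> nat \<Rightarrow> real" where
  "u d j t = of_bool
     ((INF P\<in>ambiguity d j. measure P {\<omega> \<in> space P. max 0 (real t - \<omega>) \<le> tolerance d})
      \<ge> 1 - risk d)"

end

theory Submission
  imports Defs
begin

text \<open>
  A feasible plan maintains component \<open>j\<close> in exactly one period \<open>s\<close>, so the random sum in the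
  chance constraint for \<open>j\<close> collapses to the single term \<open>[s - \<omega> j]\<^sub>+\<close>
  (\<open>delay_sum_eq\<close>). That term depends on the coordinate \<open>\<omega> j\<close> alone, whose marginal under
  a product measure is its \<open>j\<close>-th factor. Every element of \<open>ambiguity d j\<close> occurs as a
  \<open>j\<close>-th factor, because the remaining factors can be taken to be the reference distributions,
  which lie at discrepancy zero from themselves. Hence the joint and the marginal
  worst-case probabilities agree (\<open>joint_worst_case_eq_marginal\<close>), and the chance constraint
  for \<open>j\<close> says precisely that \<open>u d j s = 1\<close>. Since \<open>xv X j t = 0\<close> in all other
  periods, this is the family of inequalities \<open>xv X j t \<le> u d j t\<close>.
\<close>

lemma measure_PiM_component:
  assumes "finite I" "\<And>i. i \<in> I \<Longrightarrow> prob_space (M i)" "j \<in> I" "{x \<in> space (M j). A x} \<in> sets (M j)"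
  shows "measure (PiM I M) {\<omega> \<in> space (PiM I M). A (\<omega> j)} = measure (M j) {x \<in> space (M j). A x}"
proof -
  have "measure (M j) {x \<in> space (M j). A x}
      = measure (distr (PiM I M) (M j) (\<lambda>\<omega>. \<omega> j)) {x \<in> space (M j). A x}"
    using assms by (simp add: distr_PiM_component)
  also have "\<dots> = measure (PiM I M)
      ((\<lambda>\<omega>. \<omega> j) -` {x \<in> space (M j). A x} \<inter> space (PiM I M))"
    using assms by (intro measure_distr) auto
  also have "(\<lambda>\<omega>. \<omega> j) -` {x \<in> space (M j). A x} \<inter> space (PiM I M)
      = {\<omega> \<in> space (PiM I M). A (\<omega> j)}"
    using assms(3) by (auto simp: space_PiM)
  finally show ?thesis by simp
qed

lemma RLD_in_ambiguity:
  assumes "valid_data d" "j \<in> comps d"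
  shows "RLD d j \<in> ambiguity d j"
  using assms by (auto simp: valid_data_def ambiguity_def)

lemma joint_worst_case_eq_marginal:
  assumes d: "valid_data d" and j: "j \<in> comps d" and A: "{x. A x} \<in> sets borel"
  shows "(INF P\<in>joint_ambiguity d. measure P {\<omega> \<in> space P. A (\<omega> j)})
       = (INF P\<in>ambiguity d j. measure P {x \<in> space P. A x})"
proof -
  have marginal: "measure (PiM (comps d) Q) {\<omega> \<in> space (PiM (comps d) Q). A (\<omega> j)}
      = measure (Q j) {x \<in> space (Q j). A x}"
    if Q: "\<forall>i\<in>comps d. Q i \<in> ambiguity d i" for Q
  proof (rule measure_PiM_component)
    show "prob_space (Q i)" if "i \<in> comps d" for i
      using Q that by (auto simp: ambiguity_def borel_distributions_def)
    have "sets (Q j) = sets borel"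
      using Q j by (auto simp: ambiguity_def borel_distributions_def)
    moreover from this have "space (Q j) = UNIV"
      using sets_eq_imp_space_eq by fastforce
    ultimately show "{x \<in> space (Q j). A x} \<in> sets (Q j)"
      using A by simp
  qed (use j in auto)
  have "(\<lambda>P. measure P {\<omega> \<in> space P. A (\<omega> j)}) ` joint_ambiguity d
      = (\<lambda>P. measure P {x \<in> space P. A x}) ` ambiguity d j" (is "?L = ?R")
  proof
    show "?L \<subseteq> ?R"
    proof
      fix v assume "v \<in> ?L"
      then obtain Q where Q: "\<forall>i\<in>comps d. Q i \<in> ambiguity d i"
        and v: "v = measure (PiM (comps d) Q) {\<omega> \<in> space (PiM (comps d) Q). A (\<omega> j)}"
        by (auto simp: joint_ambiguity_def)
      show "v \<in> ?R"
        unfolding v marginal[OF Q] using Q j by (intro imageI) auto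
    qed
  next
    show "?R \<subseteq> ?L"
    proof
      fix v assume "v \<in> ?R"
      then obtain P where P: "P \<in> ambiguity d j" and v: "v = measure P {x \<in> space P. A x}"
        by auto
      \<comment> \<open>the reference distributions serve as the factors other than the \<open>j\<close>-th\<close>
      define Q where "Q = (RLD d)(j := P)"
      have Q: "\<forall>i\<in>comps d. Q i \<in> ambiguity d i"
        using P RLD_in_ambiguity[OF d] by (auto simp: Q_def)
      have "v = measure (PiM (comps d) Q) {\<omega> \<in> space (PiM (comps d) Q). A (\<omega> j)}"
        unfolding marginal[OF Q] v by (simp add: Q_def)
      moreover have "PiM (comps d) Q \<in> joint_ambiguity d"
        using Q by (auto simp: joint_ambiguity_def)
      ultimately show "v \<in> ?L" by (rule image_eqI)
    qed
  qed
  then show ?thesis by simp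
qed

lemma feasible_plan_unique_period:
  assumes X: "X \<in> feasible_plans d" and j: "j \<in> comps d"
  obtains s where "s \<in> periods d" "xv X j s = 1"
    "\<And>t. t \<in> periods d \<Longrightarrow> t \<noteq> s \<Longrightarrow> xv X j t = 0"
proof -
  have bin: "xv X j t \<in> {0, 1}" if "t \<in> periods d" for t
  proof -
    have "xv X \<in> comps d \<rightarrow>\<^sub>E (periods d \<rightarrow>\<^sub>E {0, 1})"
      using X by (simp add: feasible_plans_def)
    then show ?thesis using j that by (meson PiE_mem)
  qed
  have one: "(\<Sum>t\<in>periods d. xv X j t) = 1"
    using X j by (simp add: feasible_plans_def)
  then have "\<exists>s\<in>periods d. xv X j s \<noteq> 0"
    by (metis sum.neutral zero_neq_one)
  then obtain s where s: "s \<in> periods d" "xv X j s = 1"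
    using bin by blast
  have "(\<Sum>t\<in>periods d - {s}. xv X j t) = 0"
    using one s by (simp add: sum_diff1)
  moreover have "\<forall>t\<in>periods d - {s}. 0 \<le> xv X j t"
    using bin by fastforce
  ultimately have "\<forall>t\<in>periods d - {s}. xv X j t = 0"
    by (subst (asm) sum_nonneg_eq_0_iff) auto
  then show thesis using s by (intro that) auto
qed

lemma delay_sum_eq:
  fixes f :: "nat \<Rightarrow> real"
  assumes "s \<in> periods d" "xv X j s = 1" "\<And>t. t \<in> periods d \<Longrightarrow> t \<noteq> s \<Longrightarrow> xv X j t = 0"
  shows "(\<Sum>t\<in>periods d. f t * xv X j t) = f s"
proof -
  have "(\<Sum>t\<in>periods d. f t * xv X j t) = (\<Sum>t\<in>periods d. if t = s then f t else 0)"
    using assms by (intro sum.cong) auto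
  then show ?thesis using assms(1) by simp
qed

lemma chance_constraint_iff:
  assumes d: "valid_data d" and X: "X \<in> feasible_plans d" and j: "j \<in> comps d"
  shows "(INF P\<in>joint_ambiguity d.
        measure P {\<omega> \<in> space P. (\<Sum>t\<in>periods d. max 0 (real t - \<omega> j) * xv X j t) \<le> tolerance d})
        \<ge> 1 - risk d
     \<longleftrightarrow> (\<forall>t\<in>periods d. xv X j t \<le> u d j t)"
proof -
  obtain s where s: "s \<in> periods d" "xv X j s = 1"
    and others: "\<And>t. t \<in> periods d \<Longrightarrow> t \<noteq> s \<Longrightarrow> xv X j t = 0"
    using feasible_plan_unique_period[OF X j] by blast
  have "{x::real. max 0 (real s - x) \<le> tolerance d} \<in> sets borel"
    by measurable
  note worst_case = joint_worst_case_eq_marginal[OF d j this]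
  have collapse: "(\<Sum>t\<in>periods d. max 0 (real t - \<omega> j) * xv X j t) = max 0 (real s - \<omega> j)" for \<omega>
    by (rule delay_sum_eq) (fact s others)+
  have "(INF P\<in>joint_ambiguity d.
        measure P {\<omega> \<in> space P. (\<Sum>t\<in>periods d. max 0 (real t - \<omega> j) * xv X j t) \<le> tolerance d})
      \<ge> 1 - risk d \<longleftrightarrow> u d j s = 1"
    unfolding collapse worst_case u_def by simp
  also have "\<dots> \<longleftrightarrow> (\<forall>t\<in>periods d. xv X j t \<le> u d j t)"
  proof
    assume "u d j s = 1"
    moreover have "0 \<le> u d j t" for t
      by (simp add: u_def)
    ultimately show "\<forall>t\<in>periods d. xv X j t \<le> u d j t"
      using s others by (metis order_refl)
  next
    assume "\<forall>t\<in>periods d. xv X j t \<le> u d j t"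
    then have "1 \<le> u d j s"
      using s by metis
    then show "u d j s = 1"
      by (simp add: u_def of_bool_def split: if_splits)
  qed
  finally show ?thesis .
qed

theorem proposition2:
  fixes d :: maintenance_data
  assumes "valid_data d"
  shows "Z1 d = {X \<in> feasible_plans d. \<forall>j\<in>comps d. \<forall>t\<in>periods d. xv X j t \<le> u d j t} \<and>
         (\<forall>j\<in>comps d. \<forall>t\<in>periods d. u d j t \<in> {0, 1})"
proof
  show "Z1 d = {X \<in> feasible_plans d. \<forall>j\<in>comps d. \<forall>t\<in>periods d. xv X j t \<le> u d j t}"
    unfolding Z1_def using chance_constraint_iff[OF assms] by (intro Collect_cong conj_cong) auto
  show "\<forall>j\<in>comps d. \<forall>t\<in>periods d. u d j t \<in> {0, 1}"
    by (simp add: u_def)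
qed

end
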